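(* Let $X$ be a graph with adjacency matrix $A$, let $A=\sum_r \theta_r E_r$ be the spectral decomposition of $A$, and let $U(t)=\exp(itA)$ be the corresponding transition matrix. If $P$ is a real density matrix (rows and columns indexed by $V(X)$), then there is a positive time $t$ such that $U(t)PU(-t)$ is real if and only if the eigenvalue support of $P$ satisfies the ratio condition.
   Context: Graphs are finite and undirected. A density matrix is a positive semidefinite (Hermitian) matrix with trace $1$; it is real if all its entries are real. In the spectral decomposition $A=\sum_r\theta_rE_r$, the $\theta_r$ are the distinct eigenvalues of $A$ and $E_r$ is the matrix of orthogonal projection onto the $\theta_r$-eigenspace. The eigenvalue support of a density matrix $P$ is the set of pairs $(\theta_r,\theta_s)$ such that $E_rPE_s\neq 0$. The eigenvalue support of $P$ satisfies the ratio condition if for any two pairs $(\theta_r,\theta_s)$ and $(\theta_k,\theta_\ell)$ in the eigenvalue support of $P$ with $\theta_k\neq\theta_\ell$ we have $\frac{\theta_r-\theta_s}{\theta_k-\theta_\ell}\in\mathbb{Q}$. *)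

theory Defs
  imports "HOL-Analysis.Analysis"
begin

text \<open>
  An undirected graph is given by its adjacency relation, a symmetric relation on a finite vertex
  type (loops are permitted and contribute a diagonal entry 1), so that matrices indexed by
  its vertices are elements of \<open>complex^'v^'v\<close>. All matrices, including the real ones, live in
  this type.
\<close>

definition adjacency_matrix :: "('v \<Rightarrow> 'v \<Rightarrow> bool) \<Rightarrow> complex^'v^'v" where
  "adjacency_matrix X = (\<chi> u v. if X u v then 1 else 0)"

definition real_matrix :: "complex^'n^'m \<Rightarrow> bool" where
  "real_matrix M \<longleftrightarrow> (\<forall>i j. M $ i $ j \<in> \<real>)"

definition cinner :: "complex^'n \<Rightarrow> complex^'n \<Rightarrow> complex" where
  "cinner x y = (\<Sum>i\<in>UNIV. cnj (x $ i) * y $ i)"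

definition hermitian :: "complex^'n^'n \<Rightarrow> bool" where
  "hermitian M \<longleftrightarrow> (\<forall>i j. M $ j $ i = cnj (M $ i $ j))"

definition pos_semidef :: "complex^'n^'n \<Rightarrow> bool" where
  "pos_semidef M \<longleftrightarrow> hermitian M \<and> (\<forall>x. cinner x (M *v x) \<in> \<real>\<^sub>\<ge>\<^sub>0)"

definition density_matrix :: "complex^'n^'n \<Rightarrow> bool" where
  "density_matrix P \<longleftrightarrow> pos_semidef P \<and> trace P = 1"

text \<open>
  The generic \<open>exp\<close> needs a Banach algebra, but \<open>*\<close> on \<open>complex^'n^'n\<close> is componentwise, so
  the exponential series is written out with the matrix product.
\<close>

definition matrix_exp :: "complex^'n^'n \<Rightarrow> complex^'n^'n" where
  "matrix_exp M = (\<Sum>k. (1 / fact k) *\<^sub>R (((**) M ^^ k) (mat 1)))"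

definition transition_matrix :: "complex^'n^'n \<Rightarrow> real \<Rightarrow> complex^'n^'n" where
  "transition_matrix A t = matrix_exp (\<chi> u v. \<i> * complex_of_real t * A $ u $ v)"

definition eigenspace :: "complex^'n^'n \<Rightarrow> complex \<Rightarrow> (complex^'n) set" where
  "eigenspace A \<theta> = {x. A *v x = \<theta> *s x}"

definition eigenvalue :: "complex^'n^'n \<Rightarrow> complex \<Rightarrow> bool" where
  "eigenvalue A \<theta> \<longleftrightarrow> (\<exists>x\<in>eigenspace A \<theta>. x \<noteq> 0)"

definition orth_projection :: "(complex^'n) set \<Rightarrow> complex^'n^'n \<Rightarrow> bool" where
  "orth_projection S E \<longleftrightarrow>
     (\<forall>x. E *v x \<in> S \<and> (\<forall>y\<in>S. cinner y (x - E *v x) = 0))"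

definition eigenprojection :: "complex^'n^'n \<Rightarrow> complex \<Rightarrow> complex^'n^'n" where
  "eigenprojection A \<theta> = (THE E. orth_projection (eigenspace A \<theta>) E)"

definition eigenvalue_support :: "complex^'n^'n \<Rightarrow> complex^'n^'n \<Rightarrow> (complex \<times> complex) set" where
  "eigenvalue_support A P =
     {(\<theta>, \<mu>). eigenvalue A \<theta> \<and> eigenvalue A \<mu> \<and>
        eigenprojection A \<theta> ** P ** eigenprojection A \<mu> \<noteq> 0}"

definition ratio_condition :: "(complex \<times> complex) set \<Rightarrow> bool" where
  "ratio_condition S \<longleftrightarrow>
     (\<forall>(\<theta>\<^sub>r, \<theta>\<^sub>s)\<in>S. \<forall>(\<theta>\<^sub>k, \<theta>\<^sub>l)\<in>S. \<theta>\<^sub>k \<noteq> \<theta>\<^sub>l \<longrightarrow> (\<theta>\<^sub>r - \<theta>\<^sub>s) / (\<theta>\<^sub>k - \<theta>\<^sub>l) \<in> \<rat>)"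

lemma cinner_add_right: "cinner x (y + z) = cinner x y + cinner x z"
  by (simp add: cinner_def algebra_simps sum.distrib)

lemma cinner_diff_right: "cinner x (y - z) = cinner x y - cinner x z"
  by (simp add: cinner_def algebra_simps sum_subtractf)

lemma cinner_scale_right: "cinner x (c *s y) = c * cinner x y"
  by (simp add: cinner_def sum_distrib_left algebra_simps)

lemma cinner_scale_left: "cinner (c *s x) y = cnj c * cinner x y"
  by (simp add: cinner_def sum_distrib_left algebra_simps)

lemma Re_cinner: "Re (cinner x y) = inner x y"
  by (simp add: cinner_def inner_vec_def inner_complex_def)

lemma cinner_self_eq_0: "cinner x x = 0 \<Longrightarrow> x = 0"
  using Re_cinner[of x x] by simp

lemma eigenspace_closed:
  "0 \<in> eigenspace A \<theta>"
  "x \<in> eigenspace A \<theta> \<Longrightarrow> y \<in> eigenspace A \<theta> \<Longrightarrow> x + y \<in> eigenspace A \<theta>"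
  "x \<in> eigenspace A \<theta> \<Longrightarrow> c *s x \<in> eigenspace A \<theta>"
  by (simp_all add: eigenspace_def matrix_vector_right_distrib vector_scalar_commute
      vector_add_ldistrib mult.commute)

lemma scaleR_eq_vector_scalar_mult: "c *\<^sub>R (x :: complex^'n) = complex_of_real c *s x"
  by (vector scaleR_conv_of_real[where 'a=complex])

lemma ex1_orth_projection_eigenspace: "\<exists>!E. orth_projection (eigenspace A \<theta>) E"
proof -
  let ?S = "eigenspace A \<theta>"
  let ?Q = "\<lambda>x p. p \<in> ?S \<and> (\<forall>y\<in>?S. cinner y (x - p) = 0)"
  have minus: "p - q \<in> ?S" if "p \<in> ?S" "q \<in> ?S" for p q
    using eigenspace_closed(2)[OF that(1) eigenspace_closed(3)[OF that(2), of "-1"]]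
    by (simp add: vector_sneg_minus1[symmetric])
  have uniq: "p = q" if "?Q x p" "?Q x q" for x p q
  proof -
    have "cinner (p - q) ((x - q) - (x - p)) = 0"
      using that minus by (simp only: cinner_diff_right) simp
    then show ?thesis using cinner_self_eq_0[of "p - q"] by simp
  qed
  have sub: "subspace ?S"
    using eigenspace_closed by (auto simp: subspace_def scaleR_eq_vector_scalar_mult)
  have ex: "\<exists>p. ?Q x p" for x
  proof -
    obtain p z where pz: "p \<in> span ?S" "\<And>w. w \<in> span ?S \<Longrightarrow> orthogonal z w" "x = p + z"
      using orthogonal_subspace_decomp_exists[of ?S x] by blast
    have "cinner y z = 0" if y: "y \<in> ?S" for y
    proof (rule complex_eqI)
      have "Re (cinner y z) = 0"
        using pz(2) y by (simp add: Re_cinner orthogonal_def inner_commute span_base)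
      then show "Re (cinner y z) = Re 0" by simp
      have "Re (cinner (\<i> *s y) z) = 0"
        using pz(2)[OF span_base[OF eigenspace_closed(3)[OF y]]]
        by (simp add: Re_cinner orthogonal_def inner_commute)
      then show "Im (cinner y z) = Im 0" by (simp add: cinner_scale_left)
    qed
    moreover have "p \<in> ?S" using pz(1) sub by (simp only: span_eq_iff[THEN iffD2])
    ultimately show ?thesis using pz(3) by (intro exI[of _ p]) simp
  qed
  define f where "f x = (THE p. ?Q x p)" for x
  have f: "?Q x (f x)" for x
    unfolding f_def using theI'[of "?Q x"] ex uniq by blast
  have fS: "f x \<in> ?S" and fO: "y \<in> ?S \<Longrightarrow> cinner y (x - f x) = 0" for x y
    using f by blast+
  have "f (x + y) = f x + f y" for x y
  proof (rule uniq[OF f])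
    show "?Q (x + y) (f x + f y)"
      by (simp add: fS fO eigenspace_closed(2) add_diff_add cinner_add_right)
  qed
  moreover have "f (c *s x) = c *s f x" for c x
  proof (rule uniq[OF f])
    show "?Q (c *s x) (c *s f x)"
      by (simp add: fS fO eigenspace_closed(3) cinner_scale_right del: vector_ssub_ldistrib
          flip: vector_ssub_ldistrib)
  qed
  ultimately have "Vector_Spaces.linear (*s) (*s) f"
    by (simp add: Vector_Spaces.linear_iff vec.vector_space_axioms)
  then have "matrix f *v x = f x" for x by (rule matrix_works)
  then have "orth_projection ?S (matrix f)" using f by (simp add: orth_projection_def)
  moreover have "E = F" if "orth_projection ?S E" "orth_projection ?S F" for E F
    using that uniq unfolding orth_projection_def matrix_eq by blast
  ultimately show ?thesis by blast
qed

lemma orth_projection_eigenprojection: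
  "orth_projection (eigenspace A \<theta>) (eigenprojection A \<theta>)"
  unfolding eigenprojection_def using ex1_orth_projection_eigenspace by (rule theI')

end

theory Submission
  imports Defs
begin

text \<open>
  Let \<open>A\<close> be a real symmetric matrix, \<open>U t = exp (i t A)\<close>, and let \<open>P\<close> be real. Entrywise
  conjugation turns \<open>U t\<close> into \<open>U (- t)\<close>, so \<open>U t ** P ** U (- t)\<close> is real exactly when it equals
  \<open>U (- t) ** P ** U t\<close>. Two matrices agree iff all their spectral blocks \<open>E\<^sub>r M E\<^sub>s\<close> agree
  (\<open>matrix_eq_iff_spectral_blocks_eq\<close>), and the block of \<open>U t ** P ** U (- t)\<close> is
  \<open>exp (i t (\<theta>\<^sub>r - \<theta>\<^sub>s)) E\<^sub>r P E\<^sub>s\<close> (\<open>spectral_block_evolution\<close>). Blocks outside the eigenvalue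
  support vanish, and on the support the phase must equal its inverse. Hence the evolved matrix
  is real at time \<open>t\<close> iff \<open>t (\<theta>\<^sub>r - \<theta>\<^sub>s)\<close> is an integer multiple of \<open>\<pi>\<close> for every pair in the
  support (\<open>real_evolution_iff\<close>).

  It remains to decide when finitely many real differences have such a common \<open>t\<close>. Dividing two
  of the relations shows that all ratios are rational. Conversely, fix a nonzero difference \<open>d\<close>;
  if \<open>N\<close> is a common denominator of the ratios of all differences to \<open>d\<close>, then
  \<open>t = N \<pi> / \<bar>d\<bar>\<close> works (\<open>ratio_condition_iff_common_period\<close>).

  The linear algebra behind this is that the eigenvectors of a Hermitian matrix span the space
  (\<open>span_eigenvectors\<close>) and that it has finitely many eigenvalues, all of them real.
\<close>

section \<open>Matrices and the sesquilinear form\<close>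

lemma cinner_commute: "cinner y x = cnj (cinner x y)"
  by (simp add: cinner_def mult.commute)

lemma cinner_diff_left: "cinner (x - y) z = cinner x z - cinner y z"
  by (simp add: cinner_def algebra_simps sum_subtractf)

lemma cinner_eqI: "x = y" if "\<And>z. cinner z x = cinner z y"
  using cinner_self_eq_0[of "x - y"] that[of "x - y"] by (simp add: cinner_diff_right)

lemma hermitian_self_adjoint:
  assumes "hermitian A"
  shows "cinner (A *v x) y = cinner x (A *v y)"
proof -
  have "cinner (A *v x) y = (\<Sum>i\<in>UNIV. \<Sum>j\<in>UNIV. cnj (A $ i $ j) * cnj (x $ j) * y $ i)"
    by (simp add: cinner_def matrix_vector_mult_def sum_distrib_right)
  also have "\<dots> = (\<Sum>j\<in>UNIV. \<Sum>i\<in>UNIV. cnj (A $ i $ j) * cnj (x $ j) * y $ i)"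
    by (rule sum.swap)
  also have "\<dots> = (\<Sum>j\<in>UNIV. \<Sum>i\<in>UNIV. cnj (x $ j) * (A $ j $ i * y $ i))"
  proof (intro sum.cong refl)
    fix i j
    have "cnj (A $ i $ j) = A $ j $ i" using assms by (metis hermitian_def)
    then show "cnj (A $ i $ j) * cnj (x $ j) * y $ i = cnj (x $ j) * (A $ j $ i * y $ i)"
      by simp
  qed
  also have "\<dots> = cinner x (A *v y)"
    by (simp add: cinner_def matrix_vector_mult_def sum_distrib_left)
  finally show ?thesis .
qed

section \<open>The spectral theorem for Hermitian matrices\<close>

text \<open>
  The Rayleigh quotient \<open>x \<bullet> f x\<close> attains a maximum \<open>c\<close> on the unit sphere of \<open>W\<close>, at \<open>w\<close> say. Then
  \<open>g x = c x - f x\<close> is positive semidefinite on \<open>W\<close> and \<open>w \<bullet> g w = 0\<close>. A semidefinite form that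
  vanishes at \<open>w\<close> has \<open>g w = 0\<close>: otherwise moving from \<open>w\<close> a little in the direction \<open>- g w\<close> would
  make it negative. Working over the reals is enough even for complex Hermitian matrices, because
  their eigenvalues are real.
\<close>

lemma self_adjoint_eigenvector_in_invariant_subspace:
  fixes f :: "'a::euclidean_space \<Rightarrow> 'a"
  assumes lin: "linear f" and adj: "\<And>x y. f x \<bullet> y = x \<bullet> f y"
    and W: "subspace W" "f ` W \<subseteq> W" "W \<noteq> {0}"
  obtains c w where "w \<in> W" "w \<noteq> 0" "f w = c *\<^sub>R w"
proof -
  let ?K = "W \<inter> sphere 0 1"
  have "compact ?K"
    using W(1) by (intro closed_Int_compact closed_subspace compact_sphere)
  moreover obtain x0 where x0: "x0 \<in> W" "x0 \<noteq> 0"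
    using W(1,3) subspace_0 by blast
  then have "x0 /\<^sub>R norm x0 \<in> ?K"
    using W(1) by (simp add: subspace_scale)
  then have "?K \<noteq> {}" by blast
  moreover have "continuous_on ?K (\<lambda>x. x \<bullet> f x)"
    using lin by (intro continuous_intros linear_continuous_on)
       (simp add: linear_conv_bounded_linear)
  ultimately obtain w where w: "w \<in> ?K" and max: "\<And>x. x \<in> ?K \<Longrightarrow> x \<bullet> f x \<le> w \<bullet> f w"
    using continuous_attains_sup[of ?K "\<lambda>x. x \<bullet> f x"] by blast
  define c where "c = w \<bullet> f w"
  define g where "g x = c *\<^sub>R x - f x" for x
  have g_add: "g (x + y) = g x + g y" and g_scale: "g (s *\<^sub>R x) = s *\<^sub>R g x" for x y s
    by (simp_all add: g_def linear_add[OF lin] linear_scale[OF lin] algebra_simps)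
  have g_adj: "g x \<bullet> y = x \<bullet> g y" for x y
    by (simp add: g_def inner_diff_left inner_diff_right adj)
  have g_nonneg: "0 \<le> x \<bullet> g x" if "x \<in> W" for x
  proof (cases "x = 0")
    case False
    define y where "y = x /\<^sub>R norm x"
    have y: "y \<in> ?K" and xy: "x = norm x *\<^sub>R y"
      using that W(1) False by (simp_all add: y_def subspace_scale)
    have "y \<bullet> y = 1" using y by (simp add: dot_square_norm)
    then have "0 \<le> y \<bullet> g y"
      using max[OF y] by (simp add: g_def inner_diff_right c_def)
    moreover have "x \<bullet> g x = (norm x)\<^sup>2 * (y \<bullet> g y)"
      using g_scale[of "norm x" y] xy by (metis inner_scaleR_left inner_scaleR_right
          mult.assoc power2_eq_square)
    ultimately show ?thesis by simp
  qed simp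
  have w1: "w \<in> W" "w \<bullet> w = 1" using w by (simp_all add: dot_square_norm)
  then have gw0: "w \<bullet> g w = 0" by (simp add: g_def inner_diff_right c_def)
  define u where "u = g w"
  have uW: "u \<in> W"
  proof -
    have "f w \<in> W" using w1(1) W(2) by blast
    then show ?thesis
      using w1(1) W(1) by (simp add: u_def g_def subspace_diff subspace_scale)
  qed
  define a where "a = u \<bullet> u"
  define b where "b = u \<bullet> g u"
  have b: "0 \<le> b" using g_nonneg[OF uW] by (simp add: b_def)
  have expand: "0 \<le> 2 * s * a + s\<^sup>2 * b" for s
  proof -
    have "w + s *\<^sub>R u \<in> W"
      using w1 uW W(1) by (simp add: subspace_add subspace_scale)
    from g_nonneg[OF this] show ?thesis
      using gw0 g_adj[of w u]
      by (simp add: g_add g_scale inner_add_left inner_add_right u_def[symmetric] a_def b_def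
          power2_eq_square algebra_simps)
  qed
  have "u = 0"
  proof (rule ccontr)
    assume "u \<noteq> 0"
    then have a: "0 < a" by (simp add: a_def)
    \<comment> \<open>Any \<open>s\<close> strictly between \<open>- 2 a / b\<close> and \<open>0\<close> would do; the \<open>+ 1\<close> covers \<open>b = 0\<close>.\<close>
    define s where "s = - a / (b + 1)"
    have sb: "s * (b + 1) = - a" using b by (simp add: s_def)
    have "s\<^sup>2 * b = s * (s * (b + 1)) - s\<^sup>2"
      by (simp add: power2_eq_square algebra_simps)
    then have "0 \<le> s * a - s\<^sup>2"
      using expand[of s] unfolding sb by (simp add: algebra_simps)
    moreover have "s < 0" using a b by (simp add: s_def field_simps)
    then have "s * a < 0" using a by (simp add: mult_neg_pos)
    ultimately show False using zero_le_power2[of s] by linarith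
  qed
  then have "f w = c *\<^sub>R w" by (simp add: u_def g_def)
  moreover have "w \<noteq> 0" using w1(2) by auto
  ultimately show ?thesis using that w1(1) by blast
qed

lemma hermitian_eigenvalue_real:
  assumes "hermitian A" "eigenvalue A \<theta>"
  shows "cnj \<theta> = \<theta>"
proof -
  obtain x where x: "A *v x = \<theta> *s x" "x \<noteq> 0"
    using assms(2) by (auto simp: eigenvalue_def eigenspace_def)
  have "cnj \<theta> * cinner x x = \<theta> * cinner x x"
    using hermitian_self_adjoint[OF assms(1), of x x]
    by (simp add: x cinner_scale_left cinner_scale_right)
  moreover have "cinner x x \<noteq> 0" using x(2) cinner_self_eq_0[of x] by blast
  ultimately show ?thesis by simp
qed

lemma hermitian_eigenvectors_orthogonal:
  assumes "hermitian A" "eigenvalue A \<theta>" "x \<in> eigenspace A \<theta>" "y \<in> eigenspace A \<mu>" "\<theta> \<noteq> \<mu>"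
  shows "cinner x y = 0"
proof -
  have "cnj \<theta> * cinner x y = \<mu> * cinner x y"
    using hermitian_self_adjoint[OF assms(1), of x y] assms(3,4)
    by (simp add: eigenspace_def cinner_scale_left cinner_scale_right)
  then show ?thesis
    using assms(5) hermitian_eigenvalue_real[OF assms(1,2)] by simp
qed

text \<open>
  One eigenvector for each eigenvalue gives a pairwise orthogonal, hence linearly independent,
  family in a finite-dimensional space.
\<close>

lemma finite_eigenvalues_hermitian:
  fixes A :: "complex^'n^'n"
  assumes "hermitian A"
  shows "finite {\<theta>. eigenvalue A \<theta>}"
proof -
  have "\<forall>\<theta>\<in>{\<theta>. eigenvalue A \<theta>}. \<exists>x. x \<in> eigenspace A \<theta> \<and> x \<noteq> 0"
    by (auto simp: eigenvalue_def)
  from bchoice[OF this] obtain v where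
    v: "\<And>\<theta>. eigenvalue A \<theta> \<Longrightarrow> v \<theta> \<in> eigenspace A \<theta> \<and> v \<theta> \<noteq> 0"
    by blast
  have orth: "cinner (v \<theta>) (v \<mu>) = 0" if "eigenvalue A \<theta>" "eigenvalue A \<mu>" "\<theta> \<noteq> \<mu>" for \<theta> \<mu>
    using hermitian_eigenvectors_orthogonal[OF assms that(1)] v that by blast
  have "inj_on v {\<theta>. eigenvalue A \<theta>}"
  proof (rule inj_onI, rule ccontr)
    fix \<theta> \<mu>
    assume *: "\<theta> \<in> {\<theta>. eigenvalue A \<theta>}" "\<mu> \<in> {\<theta>. eigenvalue A \<theta>}" "v \<theta> = v \<mu>" "\<theta> \<noteq> \<mu>"
    then have "cinner (v \<theta>) (v \<theta>) = 0" using orth[of \<theta> \<mu>] by simp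
    then show False using v[of \<theta>] cinner_self_eq_0 *(1) by blast
  qed
  moreover have "pairwise orthogonal (v ` {\<theta>. eigenvalue A \<theta>})"
  proof -
    have "orthogonal (v \<theta>) (v \<mu>)" if "eigenvalue A \<theta>" "eigenvalue A \<mu>" "\<theta> \<noteq> \<mu>" for \<theta> \<mu>
      using orth[OF that] Re_cinner[of "v \<theta>" "v \<mu>"] by (simp add: orthogonal_def)
    then show ?thesis unfolding pairwise_def by blast
  qed
  then have "independent (v ` {\<theta>. eigenvalue A \<theta>})"
    using v by (intro pairwise_orthogonal_independent) auto
  then have "finite (v ` {\<theta>. eigenvalue A \<theta>})"
    by (rule independent_imp_finite)
  ultimately show ?thesis by (simp add: finite_image_iff)
qed

lemma linear_matrix_vector: "linear ((*v) (A :: complex^'n^'m))"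
  by (rule linearI)
    (simp_all add: matrix_vector_right_distrib scaleR_eq_vector_scalar_mult vector_scalar_commute)

text \<open>
  The orthogonal complement of all eigenvectors is invariant under \<open>A\<close>. Were it nonzero, it would
  contain an eigenvector, which would then be orthogonal to itself.
\<close>

lemma orthogonal_to_eigenvectors_imp_0:
  fixes A :: "complex^'n^'n"
  assumes A: "hermitian A"
    and x: "\<And>\<theta> y. eigenvalue A \<theta> \<Longrightarrow> y \<in> eigenspace A \<theta> \<Longrightarrow> cinner y x = 0"
  shows "x = 0"
proof (rule ccontr)
  assume "x \<noteq> 0"
  define W where "W = {w. \<forall>\<theta> y. eigenvalue A \<theta> \<longrightarrow> y \<in> eigenspace A \<theta> \<longrightarrow> cinner y w = 0}"
  have "subspace W"
    by (auto simp: subspace_def W_def cinner_add_right scaleR_eq_vector_scalar_mult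
        cinner_scale_right) (simp add: cinner_def)
  moreover have "(*v) A ` W \<subseteq> W"
  proof -
    have "cinner y (A *v w) = 0" if "w \<in> W" "eigenvalue A \<theta>" "y \<in> eigenspace A \<theta>" for w \<theta> y
    proof -
      have "cinner y (A *v w) = cinner (A *v y) w" by (simp add: hermitian_self_adjoint[OF A])
      also have "\<dots> = cnj \<theta> * cinner y w"
        using that(3) by (simp add: eigenspace_def cinner_scale_left)
      finally show ?thesis using that by (simp add: W_def)
    qed
    then show ?thesis by (auto simp: W_def)
  qed
  moreover have "W \<noteq> {0}"
    using x \<open>x \<noteq> 0\<close> by (auto simp: W_def)
  moreover have "(A *v u) \<bullet> w = u \<bullet> (A *v w)" for u w
    by (metis Re_cinner hermitian_self_adjoint[OF A])
  ultimately obtain w c where w: "w \<in> W" "w \<noteq> 0" "A *v w = c *\<^sub>R w"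
    using self_adjoint_eigenvector_in_invariant_subspace[OF linear_matrix_vector] by metis
  then have "w \<in> eigenspace A (complex_of_real c)"
    by (simp add: eigenspace_def scaleR_eq_vector_scalar_mult)
  then have "cinner w w = 0"
    using w(1,2) by (auto simp: W_def eigenvalue_def)
  then show False using w(2) cinner_self_eq_0 by blast
qed

lemma span_eigenvectors:
  fixes A :: "complex^'n^'n"
  assumes "hermitian A"
  shows "span (\<Union>\<theta>\<in>{\<theta>. eigenvalue A \<theta>}. eigenspace A \<theta>) = UNIV" (is "span ?S = _")
proof -
  have "x \<in> span ?S" for x
  proof -
    obtain y z where yz: "y \<in> span ?S" "\<And>w. w \<in> span ?S \<Longrightarrow> orthogonal z w" "x = y + z"
      using orthogonal_subspace_decomp_exists[of ?S x] by blast
    have "cinner y z = 0" if y: "eigenvalue A \<theta>" "y \<in> eigenspace A \<theta>" for y \<theta>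
    proof (rule complex_eqI)
      \<comment> \<open>The real decomposition only gives \<open>Re (cinner y z) = 0\<close>; applying this to \<open>\<i> *s y\<close> as well
        gives the imaginary part.\<close>
      have Re: "Re (cinner u z) = 0" if "u \<in> eigenspace A \<theta>" for u
        using yz(2)[OF span_base, of u] that y(1)
        by (auto simp: Re_cinner orthogonal_def inner_commute)
      from Re[OF y(2)] show "Re (cinner y z) = Re 0" by simp
      from Re[OF eigenspace_closed(3)[OF y(2), of \<i>]]
      show "Im (cinner y z) = Im 0" by (simp add: cinner_scale_left)
    qed
    then have "z = 0" by (rule orthogonal_to_eigenvectors_imp_0[OF assms])
    then show ?thesis using yz by simp
  qed
  then show ?thesis by blast
qed

section \<open>Spectral projections\<close>

lemma eigenprojection_in_eigenspace: "eigenprojection A \<theta> *v x \<in> eigenspace A \<theta>"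
  and eigenprojection_orthogonal:
    "y \<in> eigenspace A \<theta> \<Longrightarrow> cinner y (x - eigenprojection A \<theta> *v x) = 0"
  using orth_projection_eigenprojection[of A \<theta>] by (auto simp: orth_projection_def)

lemma eigenprojection_self_adjoint:
  "cinner (eigenprojection A \<theta> *v x) y = cinner x (eigenprojection A \<theta> *v y)"
proof -
  let ?E = "eigenprojection A \<theta>"
  have *: "cinner (?E *v x) y = cinner (?E *v x) (?E *v y)" for x y
    using eigenprojection_orthogonal[OF eigenprojection_in_eigenspace, of A \<theta> x y]
    by (simp add: cinner_diff_right)
  show ?thesis
    using *[of x y] *[of y x] cinner_commute by metis
qed

lemma eigenprojection_fixes:
  assumes "y \<in> eigenspace A \<theta>"
  shows "eigenprojection A \<theta> *v y = y"
proof -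
  let ?p = "eigenprojection A \<theta> *v y"
  have "cinner (y - ?p) (y - ?p) = 0"
    using eigenprojection_orthogonal[of _ A \<theta> y] assms eigenprojection_in_eigenspace[of A \<theta> y]
    by (simp add: cinner_diff_left)
  then show ?thesis using cinner_self_eq_0[of "y - ?p"] by simp
qed

text \<open>
  The adjoint of the relation \<open>A E = \<theta> E\<close>, with \<open>\<theta>\<close> real and both \<open>A\<close> and \<open>E\<close> self-adjoint.
\<close>

lemma eigenprojection_absorbs:
  assumes "hermitian A" "eigenvalue A \<theta>"
  shows "eigenprojection A \<theta> *v (A *v x) = \<theta> *s (eigenprojection A \<theta> *v x)"
proof (rule cinner_eqI)
  fix z
  let ?E = "eigenprojection A \<theta>"
  have "cinner z (?E *v (A *v x)) = cinner (A *v (?E *v z)) x"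
    by (simp add: eigenprojection_self_adjoint[symmetric] hermitian_self_adjoint[OF assms(1)])
  also have "A *v (?E *v z) = \<theta> *s (?E *v z)"
    using eigenprojection_in_eigenspace[of A \<theta> z] by (simp only: eigenspace_def mem_Collect_eq)
  finally show "cinner z (?E *v (A *v x)) = cinner z (\<theta> *s (?E *v x))"
    using hermitian_eigenvalue_real[OF assms]
    by (simp add: cinner_scale_left cinner_scale_right eigenprojection_self_adjoint)
qed

text \<open>
  This stands in for the resolution of the identity \<open>\<Sum>\<^sub>r E\<^sub>r = 1\<close>. Agreement on an eigenvector \<open>y\<close>
  follows since \<open>M y - N y\<close> is orthogonal to every eigenvector \<open>z\<close>: projections fix their own
  eigenvectors and can be moved across the form. Linearity does the rest, as eigenvectors span.
\<close>

lemma matrix_eq_iff_spectral_blocks_eq: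
  fixes A M N :: "complex^'n^'n"
  assumes A: "hermitian A"
  shows "M = N \<longleftrightarrow> (\<forall>\<theta> \<mu> x. eigenvalue A \<theta> \<longrightarrow> eigenvalue A \<mu> \<longrightarrow>
    eigenprojection A \<theta> *v (M *v (eigenprojection A \<mu> *v x)) =
    eigenprojection A \<theta> *v (N *v (eigenprojection A \<mu> *v x)))" (is "_ \<longleftrightarrow> ?blocks")
proof
  assume blocks: ?blocks
  have eigen: "M *v y = N *v y" if y: "eigenvalue A \<mu>" "y \<in> eigenspace A \<mu>" for \<mu> y
  proof -
    have "M *v y - N *v y = 0"
    proof (rule orthogonal_to_eigenvectors_imp_0[OF A])
      fix \<theta> z
      assume z: "eigenvalue A \<theta>" "z \<in> eigenspace A \<theta>"
      have "cinner z (M *v y) = cinner z (eigenprojection A \<theta> *v (M *v y))"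
        by (metis eigenprojection_self_adjoint eigenprojection_fixes[OF z(2)])
      also have "\<dots> = cinner z (eigenprojection A \<theta> *v (N *v y))"
        using blocks z(1) y(1) eigenprojection_fixes[OF y(2)] by metis
      also have "\<dots> = cinner z (N *v y)"
        by (metis eigenprojection_self_adjoint eigenprojection_fixes[OF z(2)])
      finally show "cinner z (M *v y - N *v y) = 0" by (simp add: cinner_diff_right)
    qed
    then show ?thesis by simp
  qed
  have "M *v y = N *v y" for y
  proof (rule linear_eq_on[OF linear_matrix_vector linear_matrix_vector])
    show "y \<in> span (\<Union>\<theta>\<in>{\<theta>. eigenvalue A \<theta>}. eigenspace A \<theta>)"
      by (simp add: span_eigenvectors[OF A])
  qed (use eigen in blast)
  then show "M = N" by (simp add: matrix_eq)
qed simp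

section \<open>The matrix exponential\<close>

text \<open>
  Matrix multiplication is bilinear in finite dimension, so \<open>norm (M ** N) \<le> K * norm M * norm N\<close>
  for some \<open>K\<close>, and the series is dominated by that of \<open>exp (K * norm M)\<close>.
\<close>

lemma summable_matrix_exp:
  fixes M :: "complex^'n^'n"
  shows "summable (\<lambda>k. (1 / fact k) *\<^sub>R (((**) M ^^ k) (mat 1)))"
proof -
  have "bilinear ((**) :: complex^'n^'n \<Rightarrow> complex^'n^'n \<Rightarrow> _)"
    by (auto simp: bilinear_def intro!: linearI)
      (simp_all add: vec_eq_iff matrix_matrix_mult_def scaleR_sum_right algebra_simps sum.distrib)
  from bilinear_bounded_pos[OF this] obtain K
    where K: "K > 0" "\<And>M N. norm ((M :: complex^'n^'n) ** (N :: complex^'n^'n)) \<le> K * norm M * norm N"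
    by blast
  have power: "norm (((**) M ^^ k) (mat 1)) \<le> (K * norm M) ^ k * norm (mat 1 :: complex^'n^'n)" for k
  proof (induction k)
    case (Suc k)
    have "norm (((**) M ^^ Suc k) (mat 1)) \<le> K * norm M * norm (((**) M ^^ k) (mat 1))"
      using K(2) by simp
    also have "\<dots> \<le> K * norm M * ((K * norm M) ^ k * norm (mat 1 :: complex^'n^'n))"
      using Suc K(1) by (intro mult_left_mono) auto
    finally show ?case by (simp add: mult.assoc)
  qed simp
  have "summable (\<lambda>k. (inverse (fact k) * (K * norm M) ^ k) * norm (mat 1 :: complex^'n^'n))"
    by (intro summable_mult2 summable_exp)
  then show ?thesis
  proof (rule summable_comparison_test'[where N = 0])
    fix k :: nat
    show "norm ((1 / fact k) *\<^sub>R (((**) M ^^ k) (mat 1))) \<le>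
        (inverse (fact k) * (K * norm M) ^ k) * norm (mat 1 :: complex^'n^'n)"
      using mult_left_mono[OF power, of "inverse (fact k)" k]
      by (simp add: divide_simps mult.assoc)
  qed
qed

lemma linear_matrix_exp:
  fixes M :: "complex^'n^'n" and f :: "complex^'n^'n \<Rightarrow> 'b::euclidean_space"
  assumes "linear f"
  shows "(\<lambda>k. (1 / fact k) *\<^sub>R f (((**) M ^^ k) (mat 1))) sums f (matrix_exp M)"
proof -
  have "bounded_linear f" using assms by (simp add: linear_conv_bounded_linear)
  from bounded_linear.sums[OF this summable_sums[OF summable_matrix_exp[of M]]]
  show ?thesis by (simp add: matrix_exp_def linear_scale[OF assms])
qed

lemma exp_scale_sums: "(\<lambda>k. (1 / fact k) *\<^sub>R (c ^ k *s v)) sums (exp c *s (v :: complex^'n))"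
proof -
  have "bounded_linear (\<lambda>c::complex. c *s v)"
    by (intro linear_conv_bounded_linear[THEN iffD1] linearI)
      (simp_all add: vec_eq_iff algebra_simps)
  from bounded_linear.sums[OF this exp_converges[of c]]
  show ?thesis
    by (simp add: divide_inverse scaleR_eq_vector_scalar_mult vector_smult_assoc
        scaleR_conv_of_real)
qed

text \<open>
  This reduces statements about the matrix exponential to its powers: a linear map that sees each
  power \<open>M\<^sup>k\<close> as the scalar \<open>c\<^sup>k\<close> sees the exponential as \<open>exp c\<close>. It serves for right and for
  left eigenvectors.
\<close>

lemma linear_matrix_exp_scale:
  fixes f :: "complex^'n^'n \<Rightarrow> complex^'n"
  assumes "linear f" "\<And>k. f (((**) M ^^ k) (mat 1)) = c ^ k *s v"
  shows "f (matrix_exp M) = exp c *s v"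
  using linear_matrix_exp[OF assms(1), of M] exp_scale_sums[of c v]
  by (simp add: assms(2) sums_unique2)

lemma linear_matrix_action: "linear (\<lambda>N. E *v (N *v (x :: complex^'n)))"
  for E :: "complex^'n^'n"
proof (rule linearI)
  fix r :: real and N :: "complex^'n^'n"
  have "(r *\<^sub>R N) *v x = r *\<^sub>R (N *v x)"
    by (simp add: vec_eq_iff matrix_vector_mult_def scaleR_sum_right)
  then show "E *v ((r *\<^sub>R N) *v x) = r *\<^sub>R (E *v (N *v x))"
    by (simp add: linear_scale[OF linear_matrix_vector])
qed (simp add: matrix_vector_mult_add_rdistrib linear_add[OF linear_matrix_vector])

lemma matrix_exp_eigenvector:
  assumes "M *v x = c *s x"
  shows "matrix_exp M *v x = exp c *s x"
proof -
  have "((**) M ^^ k) (mat 1) *v x = c ^ k *s x" for k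
    by (induction k)
      (simp_all add: matrix_vector_mul_assoc[symmetric] vector_scalar_commute assms
        vector_smult_assoc mult.commute)
  then show ?thesis
    using linear_matrix_exp_scale[OF linear_matrix_action[of "mat 1" x]] by simp
qed

lemma left_eigenmatrix_matrix_exp:
  fixes E M :: "complex^'n^'n"
  assumes "\<And>x. E *v (M *v x) = c *s (E *v x)"
  shows "E *v (matrix_exp M *v x) = exp c *s (E *v x)"
proof (rule linear_matrix_exp_scale[OF linear_matrix_action[of E x], of M c "E *v x"])
  show "E *v (((**) M ^^ k) (mat 1) *v x) = c ^ k *s (E *v x)" for k
    by (induction k)
      (simp_all add: matrix_vector_mul_assoc[symmetric] assms vector_smult_assoc)
qed

definition conj_matrix :: "complex^'n^'m \<Rightarrow> complex^'n^'m" where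
  "conj_matrix M = (\<chi> i j. cnj (M $ i $ j))"

lemma real_matrix_iff_conj_matrix: "real_matrix M \<longleftrightarrow> conj_matrix M = M"
  by (simp add: real_matrix_def conj_matrix_def vec_eq_iff Reals_cnj_iff)

lemma conj_matrix_mult: "conj_matrix (M ** N) = conj_matrix M ** conj_matrix N"
  by (simp add: conj_matrix_def matrix_matrix_mult_def vec_eq_iff)

lemma conj_matrix_exp: "conj_matrix (matrix_exp M) = matrix_exp (conj_matrix M)"
proof -
  have lin: "linear (conj_matrix :: complex^'n^'n \<Rightarrow> _)"
    by (intro linearI) (simp_all add: conj_matrix_def vec_eq_iff)
  have "conj_matrix (((**) M ^^ k) (mat 1)) = ((**) (conj_matrix M) ^^ k) (mat 1)" for k
    by (induction k) (simp_all add: conj_matrix_mult, simp add: conj_matrix_def mat_def vec_eq_iff)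
  then show ?thesis
    using linear_matrix_exp[OF lin, of M] by (simp add: matrix_exp_def sums_unique)
qed

section \<open>Transition matrices\<close>

lemma conj_transition_matrix:
  assumes "real_matrix A"
  shows "conj_matrix (transition_matrix A t) = transition_matrix A (- t)"
proof -
  have "conj_matrix (\<chi> u v. \<i> * complex_of_real t * A $ u $ v) =
      (\<chi> u v. \<i> * complex_of_real (- t) * A $ u $ v)"
    using assms by (simp add: conj_matrix_def real_matrix_def vec_eq_iff Reals_cnj_iff)
  then show ?thesis by (simp add: transition_matrix_def conj_matrix_exp)
qed

lemma scaled_matrix_vector: "(\<chi> u v. c * A $ u $ v) *v x = c *s (A *v x)"
  for A :: "complex^'n^'m"
  by (simp add: matrix_vector_mult_def vec_eq_iff sum_distrib_left mult.assoc)

lemma transition_matrix_eigenprojection: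
  "transition_matrix A t *v (eigenprojection A \<theta> *v x) =
     exp (\<i> * t * \<theta>) *s (eigenprojection A \<theta> *v x)"
  unfolding transition_matrix_def
  using eigenprojection_in_eigenspace[of A \<theta> x]
  by (intro matrix_exp_eigenvector) (simp add: scaled_matrix_vector eigenspace_def vector_smult_assoc)

lemma eigenprojection_transition_matrix:
  assumes "hermitian A" "eigenvalue A \<theta>"
  shows "eigenprojection A \<theta> *v (transition_matrix A t *v x) =
     exp (\<i> * t * \<theta>) *s (eigenprojection A \<theta> *v x)"
  unfolding transition_matrix_def
  by (intro left_eigenmatrix_matrix_exp)
    (simp add: scaled_matrix_vector vector_scalar_commute eigenprojection_absorbs[OF assms] vector_smult_assoc)

text \<open>
  \<open>E\<^sub>\<theta>\<close> absorbs the left factor \<open>U t\<close> as \<open>exp (i t \<theta>)\<close>, and the right factor \<open>U (- t)\<close> acts on the range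
  of \<open>E\<^sub>\<mu>\<close> as \<open>exp (- i t \<mu>)\<close>.
\<close>

lemma spectral_block_evolution:
  assumes "hermitian A" "eigenvalue A \<theta>"
  shows "eigenprojection A \<theta> *v ((transition_matrix A t ** P ** transition_matrix A (- t)) *v
      (eigenprojection A \<mu> *v x)) =
    exp (\<i> * t * (\<theta> - \<mu>)) *s (eigenprojection A \<theta> *v (P *v (eigenprojection A \<mu> *v x)))"
  by (simp add: matrix_vector_mul_assoc[symmetric] transition_matrix_eigenprojection
      eigenprojection_transition_matrix[OF assms] vector_scalar_commute vector_smult_assoc
      exp_add[symmetric] algebra_simps)

text \<open>
  The two exponents may differ by \<open>2 \<pi> i n\<close> and are themselves \<open>2 i t d\<close> apart, which is why \<open>t d\<close>
  runs through all multiples of \<open>\<pi>\<close>, not just the even ones.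
\<close>

lemma exp_eq_exp_minus_iff:
  "exp (\<i> * t * d) = exp (\<i> * (- t) * d) \<longleftrightarrow> (\<exists>n::int. t * d = n * pi)" for t d :: complex
proof -
  have "exp (\<i> * t * d) = exp (\<i> * (- t) * d) \<longleftrightarrow>
     (\<exists>n::int. \<i> * t * d = \<i> * (- t) * d + (of_int (2 * n) * pi) * \<i>)"
    by (rule exp_eq)
  also have "\<dots> \<longleftrightarrow> (\<exists>n::int. t * d = n * pi)"
  proof (intro ex_cong1)
    fix n :: int
    have "\<i> * t * d = \<i> * (- t) * d + (of_int (2 * n) * pi) * \<i> \<longleftrightarrow>
       (2 * \<i>) * (t * d) = (2 * \<i>) * (n * pi)" by (auto simp: algebra_simps)
    also have "\<dots> \<longleftrightarrow> t * d = n * pi" by (subst mult_cancel_left) simp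
    finally show "\<i> * t * d = \<i> * (- t) * d + (of_int (2 * n) * pi) * \<i> \<longleftrightarrow> t * d = n * pi" .
  qed
  finally show ?thesis .
qed

lemma real_evolution_iff:
  fixes A P :: "complex^'n^'n"
  assumes A: "hermitian A" "real_matrix A" and P: "real_matrix P"
  shows "real_matrix (transition_matrix A t ** P ** transition_matrix A (- t)) \<longleftrightarrow>
    (\<forall>(\<theta>, \<mu>)\<in>eigenvalue_support A P. \<exists>n::int. t * (\<theta> - \<mu>) = n * pi)"
proof -
  let ?B = "\<lambda>t. transition_matrix A t ** P ** transition_matrix A (- t)"
  let ?block = "\<lambda>\<theta> \<mu> x. eigenprojection A \<theta> *v (P *v (eigenprojection A \<mu> *v x))"
  have conj: "conj_matrix (?B t) = ?B (- t)"
    using P by (simp add: conj_matrix_mult conj_transition_matrix[OF A(2)]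
        real_matrix_iff_conj_matrix)
  have supp: "(\<theta>, \<mu>) \<in> eigenvalue_support A P \<longleftrightarrow>
      eigenvalue A \<theta> \<and> eigenvalue A \<mu> \<and> (\<exists>x. ?block \<theta> \<mu> x \<noteq> 0)" for \<theta> \<mu>
    by (simp add: eigenvalue_support_def matrix_eq[of _ 0] matrix_vector_mul_assoc[symmetric])
  have "real_matrix (?B t) \<longleftrightarrow> ?B t = ?B (- t)"
    using conj by (auto simp: real_matrix_iff_conj_matrix)
  also have "\<dots> \<longleftrightarrow> (\<forall>\<theta> \<mu> x. eigenvalue A \<theta> \<longrightarrow> eigenvalue A \<mu> \<longrightarrow>
      exp (\<i> * t * (\<theta> - \<mu>)) *s ?block \<theta> \<mu> x = exp (\<i> * (- t) * (\<theta> - \<mu>)) *s ?block \<theta> \<mu> x)"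
    using spectral_block_evolution[OF A(1), of _ t P]
      spectral_block_evolution[OF A(1), of _ "- t" P]
    by (subst matrix_eq_iff_spectral_blocks_eq[OF A(1)]) auto
  also have "\<dots> \<longleftrightarrow> (\<forall>(\<theta>, \<mu>)\<in>eigenvalue_support A P.
      exp (\<i> * t * (\<theta> - \<mu>)) = exp (\<i> * (- t) * (\<theta> - \<mu>)))"
  proof -
    have "(\<forall>x. e *s ?block \<theta> \<mu> x = e' *s ?block \<theta> \<mu> x) \<longleftrightarrow> e = e' \<or> \<not> (\<exists>x. ?block \<theta> \<mu> x \<noteq> 0)"
      for e e' \<theta> \<mu>
      by (auto simp: vector_mul_rcancel)
    then show ?thesis unfolding supp Ball_def split_paired_All prod.case by blast
  qed
  finally show ?thesis
    using exp_eq_exp_minus_iff[of "complex_of_real t"] by simp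
qed

section \<open>The ratio condition\<close>

lemma common_denominator:
  fixes R :: "'a::field_char_0 set"
  assumes "finite R" "R \<subseteq> \<rat>"
  obtains N :: nat where "N > 0" "\<And>r. r \<in> R \<Longrightarrow> of_nat N * r \<in> \<int>"
proof -
  have "\<exists>N::nat. N > 0 \<and> (\<forall>r\<in>R. of_nat N * r \<in> \<int>)"
    using assms
  proof (induction rule: finite_induct)
    case (insert q R)
    then obtain N :: nat where N: "N > 0" "\<And>r. r \<in> R \<Longrightarrow> of_nat N * r \<in> \<int>" by auto
    obtain a b where ab: "b > 0" "q = of_int a / of_int b"
      using insert.prems by (auto elim: Rats_cases')
    have "of_nat (N * nat b) * r \<in> \<int>" if r: "r \<in> insert q R" for r
    proof (cases "r = q")
      case True
      then have "of_nat (N * nat b) * r = of_int (int N * a)" using ab by simp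
      then show ?thesis by (metis Ints_of_int)
    next
      case False
      have "of_nat (N * nat b) * r = of_nat (nat b) * (of_nat N * r)" by simp
      then show ?thesis using N(2) False r by (metis Ints_mult Ints_of_nat insertE)
    qed
    then show ?case using N(1) ab(1) by (intro exI[of _ "N * nat b"]) auto
  qed (auto intro: exI[of _ 1])
  then show ?thesis using that by blast
qed

text \<open>
  Finiteness of \<open>S\<close> provides the common denominator of the ratios. Realness of the differences is
  what allows a real \<open>t\<close>: the ratio condition alone determines the differences only up to a common
  complex factor.
\<close>

lemma ratio_condition_iff_common_period:
  assumes fin: "finite S" and real: "\<And>\<theta> \<mu>. (\<theta>, \<mu>) \<in> S \<Longrightarrow> \<theta> - \<mu> \<in> \<real>"
  shows "(\<exists>t>0. \<forall>(\<theta>, \<mu>)\<in>S. \<exists>n::int. complex_of_real t * (\<theta> - \<mu>) = n * pi) \<longleftrightarrow>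
    ratio_condition S"
proof
  assume "\<exists>t>0. \<forall>(\<theta>, \<mu>)\<in>S. \<exists>n::int. complex_of_real t * (\<theta> - \<mu>) = n * pi"
  then obtain t where t: "t > 0" "\<And>\<theta> \<mu>. (\<theta>, \<mu>) \<in> S \<Longrightarrow> \<exists>n::int. complex_of_real t * (\<theta> - \<mu>) = n * pi"
    by blast
  have "(a - b) / (c - d) \<in> \<rat>" if S: "(a, b) \<in> S" "(c, d) \<in> S" for a b c d
  proof -
    obtain m n :: int where "complex_of_real t * (a - b) = m * pi" "complex_of_real t * (c - d) = n * pi"
      using t(2) S by meson
    moreover have "(a - b) / (c - d) = (complex_of_real t * (a - b)) / (complex_of_real t * (c - d))"
      using t(1) by simp
    ultimately have "(a - b) / (c - d) = of_int m / of_int n" by simp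
    then show ?thesis by simp
  qed
  then show "ratio_condition S" by (auto simp: ratio_condition_def)
next
  assume ratio: "ratio_condition S"
  show "\<exists>t>0. \<forall>(\<theta>, \<mu>)\<in>S. \<exists>n::int. complex_of_real t * (\<theta> - \<mu>) = n * pi"
  proof (cases "\<forall>(\<theta>, \<mu>)\<in>S. \<theta> = \<mu>")
    case True
    then have "\<forall>(\<theta>, \<mu>)\<in>S. \<exists>n::int. complex_of_real 1 * (\<theta> - \<mu>) = n * pi"
      by (auto intro: exI[of _ 0])
    then show ?thesis using zero_less_one by blast
  next
    case False
    then obtain a b where ab: "(a, b) \<in> S" "a \<noteq> b" by blast
    then obtain d where d: "a - b = complex_of_real d" "d \<noteq> 0"
      using real[OF ab(1)] by (metis Reals_cases eq_iff_diff_eq_0 of_real_0)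
    let ?q = "\<lambda>(\<theta>, \<mu>). (\<theta> - \<mu>) / (a - b)"
    have "?q ` S \<subseteq> \<rat>"
    proof -
      have "(\<theta> - \<mu>) / (a - b) \<in> \<rat>" if "(\<theta>, \<mu>) \<in> S" for \<theta> \<mu>
      proof -
        from bspec[OF ratio[unfolded ratio_condition_def] that]
        have "\<forall>(c, d)\<in>S. c \<noteq> d \<longrightarrow> (\<theta> - \<mu>) / (c - d) \<in> \<rat>" by simp
        from bspec[OF this ab(1)] ab(2) show ?thesis by simp
      qed
      then show ?thesis by auto
    qed
    then obtain N :: nat where N: "N > 0" "\<And>r. r \<in> ?q ` S \<Longrightarrow> of_nat N * r \<in> \<int>"
      using common_denominator[of "?q ` S"] fin by blast
    \<comment> \<open>The absolute value makes \<open>t\<close> positive and costs only a sign in the integer multiple.\<close>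
    define t where "t = N * pi / \<bar>d\<bar>"
    have "\<exists>n::int. complex_of_real t * (\<theta> - \<mu>) = n * pi" if S: "(\<theta>, \<mu>) \<in> S" for \<theta> \<mu>
    proof -
      obtain m :: int where m: "of_nat N * ((\<theta> - \<mu>) / (a - b)) = of_int m"
        using N(2)[OF imageI[OF S]] by (auto elim: Ints_cases)
      have "t = sgn d * (N * pi / d)" using d(2) by (simp add: t_def sgn_if)
      then have "complex_of_real t * (\<theta> - \<mu>) =
           of_real (sgn d) * (of_nat N * ((\<theta> - \<mu>) / (a - b))) * pi"
        by (simp add: d(1))
      also have "\<dots> = of_int ((if d > 0 then 1 else -1) * m) * pi"
        using d(2) by (simp only: m) (simp add: sgn_if)
      finally show ?thesis by blast
    qed
    moreover have "t > 0" using N(1) d(2) by (simp add: t_def)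
    ultimately show ?thesis by blast
  qed
qed

theorem theorem2p2:
  fixes X :: "'v::finite \<Rightarrow> 'v \<Rightarrow> bool"
    and A P :: "complex^'v^'v"
    and U :: "real \<Rightarrow> complex^'v^'v"
  assumes "symp X"
    and "A = adjacency_matrix X"
    and "U = transition_matrix A"
    and "density_matrix P" and "real_matrix P"
  shows "(\<exists>t>0. real_matrix (U t ** P ** U (- t))) \<longleftrightarrow>
         ratio_condition (eigenvalue_support A P)"
proof -
  have A: "hermitian A" "real_matrix A"
    using assms(1,2) by (auto simp: hermitian_def real_matrix_def adjacency_matrix_def dest: sympD)
  have "finite (eigenvalue_support A P)"
  proof (rule finite_subset)
    show "eigenvalue_support A P \<subseteq> {\<theta>. eigenvalue A \<theta>} \<times> {\<theta>. eigenvalue A \<theta>}"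
      by (auto simp: eigenvalue_support_def)
  qed (simp add: finite_eigenvalues_hermitian[OF A(1)])
  moreover have "\<theta> - \<mu> \<in> \<real>" if "(\<theta>, \<mu>) \<in> eigenvalue_support A P" for \<theta> \<mu>
    using that hermitian_eigenvalue_real[OF A(1)]
    by (auto simp: eigenvalue_support_def Reals_cnj_iff)
  ultimately show ?thesis
    unfolding assms(3) real_evolution_iff[OF A assms(5)]
    by (rule ratio_condition_iff_common_period)
qed

end
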